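(* Let $K, M\in\mathbb{C}^{n\times n}$ be invertible, let $0\neq b\in\mathbb{C}^n$, let $\sigma_1,\dots,\sigma_{n_f}\in\mathbb{C}$ be such that each $K+\sigma_jM$ is invertible, let $\tau_1,\dots,\tau_m\in\mathbb{C}$ be such that each $K+\tau_k M$ is invertible, and let $\varepsilon>0$. Let $\tilde Z_m$, $\bar H_m$ and $V_{m+1}$ be computed by $m$ steps of the inexact flexible Arnoldi algorithm (described in the context), in which the inner residuals $p_k=v_k-(K+\tau_kM)\tilde z_k$ satisfy $\|p_k\|_2\le\varepsilon$ for $k=1,\dots,m$. For each $j=1,\dots,n_f$ let $x_m(\sigma_j)=\tilde Z_my_m(\sigma_j)$ with $y_m(\sigma_j)\in\mathbb{C}^m$ be an approximate solution of $(K+\sigma_jM)x=b$, with true residual $r_m(\sigma_j)=b-(K+\sigma_jM)\tilde Z_my_m(\sigma_j)$ and inexact residual $\tilde r_m(\sigma_j)=V_{m+1}\left(\beta e_1-\bar H_m(\sigma_j;T_m)y_m(\sigma_j)\right)$. Then $$\|r_m(\sigma_j)-\tilde r_m(\sigma_j)\|_2\le\varepsilon\,\|y_m(\sigma_j)\|_1$$ and $$\|r_m(\sigma_j)\|_2\le\varepsilon\,\|y_m(\sigma_j)\|_1+\|\beta e_1-\bar H_m(\sigma_j;T_m)y_m(\sigma_j)\|_2 .$$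
   Context: Notation: $\|\cdot\|_2$ is the Euclidean norm, $\|\cdot\|_1$ is the vector 1-norm, $^*$ is the conjugate transpose, and $e_1$ is the first canonical basis vector of $\mathbb{C}^{m+1}$. Inexact flexible Arnoldi algorithm (modified Gram--Schmidt): set $\beta=\|b\|_2$, $v_1=b/\beta$, and initialize the $(m+1)\times m$ matrix $\bar H_m=(h_{i,k})$ to zero. For $k=1,\dots,m$: compute (by some inner iterative solver) an approximate solution $\tilde z_k\approx(K+\tau_kM)^{-1}v_k$, with inner residual $p_k:=v_k-(K+\tau_kM)\tilde z_k$; set $w_k:=M\tilde z_k$; for $i=1,\dots,k$ set $h_{i,k}:=v_i^*w_k$ and replace $w_k$ by $w_k-h_{i,k}v_i$; then set $h_{k+1,k}:=\|w_k\|_2$, stop if $h_{k+1,k}=0$, and otherwise set $v_{k+1}:=w_k/h_{k+1,k}$. It is understood that the $m$ steps have been completed without stopping, so that $v_1,\dots,v_{m+1}$ are all defined (and orthonormal). Set $V_{m+1}=[v_1,\dots,v_{m+1}]$, $\tilde Z_m=[\tilde z_1,\dots,\tilde z_m]$, $T_m=\mathrm{diag}\{\tau_1,\dots,\tau_m\}$, and define $$\bar H_m(\sigma;T_m)=\begin{bmatrix}I_m\\0\end{bmatrix}+\bar H_m(\sigma I_m-T_m)\in\mathbb{C}^{(m+1)\times m}.$$ *)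

theory Defs
  imports
    "Jordan_Normal_Form.Matrix"
    "Jordan_Normal_Form.Conjugate"
    "HOL-Analysis.L2_Norm"
begin

definition norm2 :: "complex vec \<Rightarrow> real" where
  "norm2 x = L2_set (\<lambda>i. cmod (x $ i)) {..<dim_vec x}"

definition norm1 :: "complex vec \<Rightarrow> real" where
  "norm1 x = (\<Sum>i<dim_vec x. cmod (x $ i))"

text \<open>
  All indices start at 0: the vectors usually written $v_1,\dots,v_{m+1}$ are
  \<open>v 0, \<dots>, v m\<close>, and step $k$ is step \<open>k - 1\<close> here.
\<close>

text \<open>
  \<open>mgs_sweep v w i\<close> is the current vector after \<open>w\<close> has been orthogonalized against
  \<open>v 0, \<dots>, v (i - 1)\<close> in turn.  Note that \<open>u \<bullet>c v i\<close> conjugates its second argument, so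
  it is $v_i^* u$.
\<close>

primrec mgs_sweep :: "(nat \<Rightarrow> complex vec) \<Rightarrow> complex vec \<Rightarrow> nat \<Rightarrow> complex vec" where
  "mgs_sweep v w 0 = w"
| "mgs_sweep v w (Suc i) =
    (let u = mgs_sweep v w i in u - (u \<bullet>c v i) \<cdot>\<^sub>v v i)"

text \<open>
  A run of \<open>m\<close> completed steps (no breakdown).  The inner solver is arbitrary, hence so are
  the \<open>z k\<close>; the inner residuals \<open>p k\<close> record their quality.
\<close>

definition inexact_flexible_arnoldi ::
  "nat \<Rightarrow> complex mat \<Rightarrow> complex mat \<Rightarrow> complex vec \<Rightarrow> (nat \<Rightarrow> complex) \<Rightarrow> nat \<Rightarrow>
   (nat \<Rightarrow> complex vec) \<Rightarrow> (nat \<Rightarrow> complex vec) \<Rightarrow> (nat \<Rightarrow> complex vec) \<Rightarrow> complex mat \<Rightarrow> bool"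
where
  "inexact_flexible_arnoldi n K M b \<tau> m v z p H \<longleftrightarrow>
     v 0 = complex_of_real (1 / norm2 b) \<cdot>\<^sub>v b \<and>
     H \<in> carrier_mat (m + 1) m \<and>
     (\<forall>k<m.
        z k \<in> carrier_vec n \<and>
        p k = v k - (K + \<tau> k \<cdot>\<^sub>m M) *\<^sub>v z k \<and>
        (let w = mgs_sweep v (M *\<^sub>v z k) in
           (\<forall>i\<le>k. H $$ (i, k) = w i \<bullet>c v i) \<and>
           H $$ (k + 1, k) = complex_of_real (norm2 (w (k + 1))) \<and>
           (\<forall>i. k + 1 < i \<and> i \<le> m \<longrightarrow> H $$ (i, k) = 0) \<and>
           H $$ (k + 1, k) \<noteq> 0 \<and>
           v (k + 1) = (1 / H $$ (k + 1, k)) \<cdot>\<^sub>v w (k + 1)))"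

definition shifted_hessenberg ::
  "nat \<Rightarrow> complex mat \<Rightarrow> complex mat \<Rightarrow> complex \<Rightarrow> complex mat" where
  "shifted_hessenberg m H T \<sigma> = (1\<^sub>m m @\<^sub>r 0\<^sub>m 1 m) + H * (\<sigma> \<cdot>\<^sub>m 1\<^sub>m m - T)"

end

theory Submission
  imports Defs
begin

text \<open>
  The only error in the process is the inner residual.  Modified Gram--Schmidt decomposes
  \<open>M z\<^sub>k\<close> exactly in the basis, whatever \<open>z\<^sub>k\<close> is (\<open>arnoldi_relation\<close>), and
  \[ (K + \sigma M) z_k = (K + \tau_k M) z_k + (\sigma - \tau_k) M z_k
       = v_k - p_k + (\sigma - \tau_k) M z_k. \]
  Collecting the columns gives \<open>(K + \<sigma>M) Z = V H(\<sigma>; T) - P\<close> with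
  \<open>P = [p\<^sub>1, \<dots>, p\<^sub>m]\<close> (\<open>shifted_arnoldi_relation\<close>).  Since \<open>b = V (\<beta> e\<^sub>1)\<close>, the true
  and the inexact residual differ by exactly \<open>P y\<close> (\<open>residual_gap\<close>), and the triangle
  inequality bounds \<open>P y\<close> by \<open>\<epsilon>\<close> times the 1-norm of \<open>y\<close>.

  The second bound is the triangle inequality once more: the columns of \<open>V\<close> are orthonormal
  (\<open>arnoldi_orthonormal\<close>), so the norm of the inexact residual is that of its coefficient
  vector.
\<close>

section \<open>The Euclidean norm\<close>

lemma norm2_triangle:
  assumes "dim_vec x = dim_vec u"
  shows "norm2 x \<le> norm2 (x - u) + norm2 u"
proof -
  have "L2_set (\<lambda>i. cmod (x $ i)) {..<dim_vec u}
      \<le> L2_set (\<lambda>i. cmod ((x - u) $ i) + cmod (u $ i)) {..<dim_vec u}"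
  proof (rule L2_set_mono)
    fix i assume "i \<in> {..<dim_vec u}"
    then show "cmod (x $ i) \<le> cmod ((x - u) $ i) + cmod (u $ i)"
      using norm_triangle_ineq[of "x $ i - u $ i" "u $ i"] by simp
  qed simp
  also have "\<dots> \<le> L2_set (\<lambda>i. cmod ((x - u) $ i)) {..<dim_vec u}
      + L2_set (\<lambda>i. cmod (u $ i)) {..<dim_vec u}"
    by (rule L2_set_triangle_ineq)
  finally show ?thesis
    using assms by (simp add: norm2_def)
qed

lemma L2_set_cmod_sum_le:
  assumes "finite S"
  shows "L2_set (\<lambda>l. cmod (\<Sum>k\<in>S. f k l)) A \<le> (\<Sum>k\<in>S. L2_set (\<lambda>l. cmod (f k l)) A)"
  using assms
proof (induction S rule: finite_induct)
  case empty
  then show ?case by (simp add: L2_set_def)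
next
  case (insert a S)
  have "L2_set (\<lambda>l. cmod (\<Sum>k\<in>insert a S. f k l)) A
      \<le> L2_set (\<lambda>l. cmod (f a l) + cmod (\<Sum>k\<in>S. f k l)) A"
    using insert.hyps by (intro L2_set_mono) (simp_all add: norm_triangle_ineq)
  also have "\<dots> \<le> L2_set (\<lambda>l. cmod (f a l)) A + L2_set (\<lambda>l. cmod (\<Sum>k\<in>S. f k l)) A"
    by (rule L2_set_triangle_ineq)
  finally show ?case
    using insert by simp
qed

lemma mat_of_cols_mult_vec_index:
  assumes "y \<in> carrier_vec m" and "l < n" and "\<And>k. k < m \<Longrightarrow> f k \<in> carrier_vec n"
  shows "(mat_of_cols n (map f [0..<m]) *\<^sub>v y) $ l = (\<Sum>k<m. f k $ l * y $ k)"
  using assms by (auto simp: scalar_prod_def mat_of_cols_index atLeast0LessThan intro!: sum.cong)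

text \<open>
  The columns \<open>f k\<close> may all point in the same direction, so the triangle inequality is the best
  available tool, and it produces the 1-norm of \<open>y\<close>.
\<close>

lemma norm2_mat_of_cols_mult_vec_le:
  assumes y: "y \<in> carrier_vec m"
    and f: "\<And>k. k < m \<Longrightarrow> f k \<in> carrier_vec n"
    and le: "\<And>k. k < m \<Longrightarrow> norm2 (f k) \<le> \<epsilon>"
  shows "norm2 (mat_of_cols n (map f [0..<m]) *\<^sub>v y) \<le> \<epsilon> * norm1 y"
proof -
  have "norm2 (mat_of_cols n (map f [0..<m]) *\<^sub>v y)
      = L2_set (\<lambda>l. cmod (\<Sum>k<m. f k $ l * y $ k)) {..<n}"
    unfolding norm2_def
    by (rule L2_set_cong) (use mat_of_cols_mult_vec_index[OF y _ f] in \<open>simp_all add: f\<close>)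
  also have "\<dots> \<le> (\<Sum>k<m. L2_set (\<lambda>l. cmod (f k $ l * y $ k)) {..<n})"
    by (rule L2_set_cmod_sum_le) simp
  also have "\<dots> \<le> (\<Sum>k<m. \<epsilon> * cmod (y $ k))"
  proof (rule sum_mono)
    fix k assume "k \<in> {..<m}"
    then have k: "k < m" by simp
    have "L2_set (\<lambda>l. cmod (f k $ l * y $ k)) {..<n} = norm2 (f k) * cmod (y $ k)"
      using f[OF k] by (simp add: norm2_def norm_mult L2_set_left_distrib)
    also have "\<dots> \<le> \<epsilon> * cmod (y $ k)"
      using le[OF k] by (rule mult_right_mono) simp
    finally show "L2_set (\<lambda>l. cmod (f k $ l * y $ k)) {..<n} \<le> \<epsilon> * cmod (y $ k)" .
  qed
  also have "\<dots> = \<epsilon> * norm1 y"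
    using y by (simp add: norm1_def sum_distrib_left)
  finally show ?thesis .
qed

lemma cscalar_prod_self: "x \<bullet>c x = complex_of_real ((norm2 x)\<^sup>2)"
proof -
  have "complex_of_real ((norm2 x)\<^sup>2) = (\<Sum>i<dim_vec x. complex_of_real ((cmod (x $ i))\<^sup>2))"
    by (simp add: norm2_def L2_set_def sum_nonneg)
  also have "\<dots> = x \<bullet>c x"
    by (simp add: scalar_prod_def atLeast0LessThan complex_norm_square[symmetric])
  finally show ?thesis by simp
qed

lemma norm2_nonneg: "0 \<le> norm2 x"
  by (simp add: norm2_def)

lemma norm2_eq_0_iff:
  assumes "x \<in> carrier_vec n"
  shows "norm2 x = 0 \<longleftrightarrow> x = 0\<^sub>v n"
  using assms by (auto simp: norm2_def L2_set_eq_0_iff)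

lemma cscalar_prod_diff_smult:
  fixes u a w :: "complex vec"
  assumes "u \<in> carrier_vec n" "a \<in> carrier_vec n" "w \<in> carrier_vec n"
  shows "(u - c \<cdot>\<^sub>v a) \<bullet>c w = u \<bullet>c w - c * (a \<bullet>c w)"
  using assms by (simp add: minus_scalar_prod_distrib[of _ n])

lemma cscalar_prod_normalized:
  assumes "w \<in> carrier_vec n" "w \<noteq> 0\<^sub>v n"
  shows "(complex_of_real (1 / norm2 w) \<cdot>\<^sub>v w) \<bullet>c (complex_of_real (1 / norm2 w) \<cdot>\<^sub>v w) = 1"
    (is "(?a \<cdot>\<^sub>v w) \<bullet>c (?a \<cdot>\<^sub>v w) = 1")
proof -
  have nz: "norm2 w \<noteq> 0"
    using assms norm2_eq_0_iff by blast
  have "(?a \<cdot>\<^sub>v w) \<bullet>c (?a \<cdot>\<^sub>v w) = ?a * (conjugate ?a * (w \<bullet>c w))"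
    using assms(1) by (simp add: conjugate_smult_vec)
  also have "\<dots> = complex_of_real (1 / norm2 w * (1 / norm2 w * (norm2 w)\<^sup>2))"
    unfolding cscalar_prod_self by simp
  also have "1 / norm2 w * (1 / norm2 w * (norm2 w)\<^sup>2) = 1"
    using nz by (simp add: power2_eq_square)
  finally show ?thesis by simp
qed

definition orthonormal_upto :: "nat \<Rightarrow> (nat \<Rightarrow> complex vec) \<Rightarrow> nat \<Rightarrow> bool" where
  "orthonormal_upto n v m \<longleftrightarrow> (\<forall>i\<le>m. v i \<in> carrier_vec n) \<and>
     (\<forall>i\<le>m. \<forall>j\<le>m. v i \<bullet>c v j = (if i = j then 1 else 0))"

text \<open>
  A matrix with orthonormal columns is an isometry: in the expansion of the squared norm of
  \<open>V c\<close> the Gram matrix of the columns appears, and it is the identity.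
\<close>

lemma norm2_orthonormal_mult_vec:
  assumes on: "orthonormal_upto n v m" and c: "c \<in> carrier_vec (m + 1)"
  shows "norm2 (mat_of_cols n (map v [0..<m + 1]) *\<^sub>v c) = norm2 c"
proof -
  let ?x = "mat_of_cols n (map v [0..<m + 1]) *\<^sub>v c"
  have v: "v i \<in> carrier_vec n" if "i < m + 1" for i
    using on that by (simp add: orthonormal_upto_def)
  have vv: "(\<Sum>l<n. v i $ l * cnj (v j $ l)) = (if i = j then 1 else 0)"
    if "i < m + 1" "j < m + 1" for i j
  proof -
    have "v i \<bullet>c v j = (if i = j then 1 else 0)"
      using on that by (simp add: orthonormal_upto_def)
    then show ?thesis
      using v[OF that(2)] by (simp add: scalar_prod_def atLeast0LessThan)
  qed
  have "?x \<bullet>c ?x = (\<Sum>l<n. ?x $ l * cnj (?x $ l))"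
    unfolding scalar_prod_def by (simp add: atLeast0LessThan)
  also have "\<dots> = (\<Sum>l<n. (\<Sum>i<m+1. v i $ l * c $ i) * cnj (\<Sum>j<m+1. v j $ l * c $ j))"
    by (rule sum.cong) (simp_all only: mat_of_cols_mult_vec_index[OF c _ v] lessThan_iff)
  also have "\<dots> = (\<Sum>l<n. \<Sum>i<m+1. \<Sum>j<m+1. c $ i * cnj (c $ j) * (v i $ l * cnj (v j $ l)))"
    by (simp only: cnj_sum sum_product complex_cnj_mult mult_ac)
  also have "\<dots> = (\<Sum>i<m+1. \<Sum>j<m+1. \<Sum>l<n. c $ i * cnj (c $ j) * (v i $ l * cnj (v j $ l)))"
    by (subst sum.swap) (intro sum.cong refl sum.swap)
  also have "\<dots> = (\<Sum>i<m+1. \<Sum>j<m+1. c $ i * cnj (c $ j) * (if i = j then 1 else 0))"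
    by (intro sum.cong refl) (simp only: sum_distrib_left[symmetric] vv lessThan_iff)
  also have "\<dots> = (\<Sum>i<m+1. c $ i * cnj (c $ i))"
    by (intro sum.cong refl) (simp add: if_distrib[of "\<lambda>t. _ * t"] cong: if_cong)
  also have "\<dots> = c \<bullet>c c"
    using c by (simp add: scalar_prod_def atLeast0LessThan)
  finally have "(norm2 ?x)\<^sup>2 = (norm2 c)\<^sup>2"
    by (simp only: cscalar_prod_self of_real_eq_iff)
  then show ?thesis
    using norm2_nonneg by (simp only: power2_eq_iff_nonneg)
qed


section \<open>Modified Gram--Schmidt\<close>

lemma mgs_sweep_carrier:
  assumes "w \<in> carrier_vec n" and "\<And>j. j < i \<Longrightarrow> v j \<in> carrier_vec n"
  shows "mgs_sweep v w i \<in> carrier_vec n"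
  using assms by (induction i) (auto simp: Let_def)

text \<open>
  The coefficients belong to the partially orthogonalized vectors, not to \<open>w\<close>; being exactly
  what each step subtracts, they recover \<open>w\<close> by telescoping.
\<close>

lemma mgs_sweep_telescope:
  assumes "w \<in> carrier_vec n" and "\<And>j. j < i \<Longrightarrow> v j \<in> carrier_vec n" and "l < n"
  shows "w $ l = mgs_sweep v w i $ l + (\<Sum>j<i. (mgs_sweep v w j \<bullet>c v j) * v j $ l)"
  using assms
proof (induction i)
  case (Suc i)
  have "w $ l = mgs_sweep v w i $ l + (\<Sum>j<i. (mgs_sweep v w j \<bullet>c v j) * v j $ l)"
    using Suc by simp
  moreover have "dim_vec (v i) = n"
    using Suc.prems(2)[of i] by simp
  ultimately show ?case
    using Suc.prems(3) by (simp add: Let_def)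
qed simp

text \<open>
  Orthogonality to \<open>v i\<close> is created by the step that subtracts the component along \<open>v i\<close>, and
  survives the later steps, which subtract multiples of vectors orthogonal to \<open>v i\<close>.
\<close>

lemma mgs_sweep_orthogonal:
  assumes on: "orthonormal_upto n v k" and w: "w \<in> carrier_vec n" and "i \<le> k + 1" and "l < i"
  shows "mgs_sweep v w i \<bullet>c v l = 0"
  using assms(3,4)
proof (induction i)
  case (Suc i)
  have vi: "v i \<in> carrier_vec n" and vl: "v l \<in> carrier_vec n"
    and il: "v i \<bullet>c v l = (if i = l then 1 else 0)"
    using on Suc.prems by (auto simp: orthonormal_upto_def)
  have u: "mgs_sweep v w i \<in> carrier_vec n"
    using on Suc.prems w by (intro mgs_sweep_carrier) (auto simp: orthonormal_upto_def)
  show ?case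
    using Suc il cscalar_prod_diff_smult[OF u vi vl]
    by (cases "i = l") (simp_all add: Let_def)
qed simp

lemma orthonormal_upto_Suc:
  assumes on: "orthonormal_upto n v k"
    and w: "w \<in> carrier_vec n" "w \<noteq> 0\<^sub>v n"
    and orth: "\<And>l. l \<le> k \<Longrightarrow> w \<bullet>c v l = 0"
    and vS: "v (Suc k) = complex_of_real (1 / norm2 w) \<cdot>\<^sub>v w"
  shows "orthonormal_upto n v (Suc k)"
proof -
  have v: "v i \<in> carrier_vec n" if "i \<le> k" for i
    using on that by (simp add: orthonormal_upto_def)
  have vS_carrier: "v (Suc k) \<in> carrier_vec n"
    using w vS by simp
  have 1: "v (Suc k) \<bullet>c v l = 0" if "l \<le> k" for l
    using orth[OF that] v[OF that] w vS by simp
  have 2: "v l \<bullet>c v (Suc k) = 0" if "l \<le> k" for l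
  proof -
    have "v l \<bullet>c v (Suc k) = conjugate (v (Suc k) \<bullet>c v l)"
      using v[OF that] vS_carrier
      by (simp add: scalar_prod_def mult.commute)
    then show ?thesis using 1[OF that] by simp
  qed
  have 3: "v (Suc k) \<bullet>c v (Suc k) = 1"
    unfolding vS by (rule cscalar_prod_normalized[OF w])
  show ?thesis
    using on 1 2 3 vS_carrier by (auto simp: orthonormal_upto_def le_Suc_eq)
qed


section \<open>The inexact flexible Arnoldi process\<close>

lemma arnoldi_step:
  assumes "inexact_flexible_arnoldi n K M b \<tau> m v z p H" and "k < m"
  shows "z k \<in> carrier_vec n \<and> p k = v k - (K + \<tau> k \<cdot>\<^sub>m M) *\<^sub>v z k \<and>
    (\<forall>i\<le>k. H $$ (i, k) = mgs_sweep v (M *\<^sub>v z k) i \<bullet>c v i) \<and>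
    H $$ (k + 1, k) = complex_of_real (norm2 (mgs_sweep v (M *\<^sub>v z k) (k + 1))) \<and>
    (\<forall>i. k + 1 < i \<and> i \<le> m \<longrightarrow> H $$ (i, k) = 0) \<and>
    H $$ (k + 1, k) \<noteq> 0 \<and>
    v (k + 1) = (1 / H $$ (k + 1, k)) \<cdot>\<^sub>v mgs_sweep v (M *\<^sub>v z k) (k + 1)"
  using assms(1)[unfolded inexact_flexible_arnoldi_def Let_def, THEN conjunct2, THEN conjunct2,
      rule_format, OF assms(2)] .

lemma arnoldi_orthonormal:
  assumes run: "inexact_flexible_arnoldi n K M b \<tau> m v z p H"
    and M: "M \<in> carrier_mat n n" and b: "b \<in> carrier_vec n" "b \<noteq> 0\<^sub>v n"
  shows "orthonormal_upto n v m"
proof -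
  have "k \<le> m \<Longrightarrow> orthonormal_upto n v k" for k
  proof (induction k)
    case 0
    have "v 0 = complex_of_real (1 / norm2 b) \<cdot>\<^sub>v b"
      using run by (simp add: inexact_flexible_arnoldi_def)
    then show ?case
      using b cscalar_prod_normalized[OF b] by (simp add: orthonormal_upto_def)
  next
    case (Suc k)
    then have on: "orthonormal_upto n v k" and k: "k < m" by simp_all
    let ?w = "mgs_sweep v (M *\<^sub>v z k) (Suc k)"
    have h: "H $$ (k + 1, k) = complex_of_real (norm2 ?w)" "H $$ (k + 1, k) \<noteq> 0"
      "v (Suc k) = (1 / H $$ (k + 1, k)) \<cdot>\<^sub>v ?w"
      using arnoldi_step[OF run k] unfolding Suc_eq_plus1 by blast+
    have Mz: "M *\<^sub>v z k \<in> carrier_vec n" using M by (intro carrier_vecI) simp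
    have w: "?w \<in> carrier_vec n"
      using on by (intro mgs_sweep_carrier[OF Mz]) (simp add: orthonormal_upto_def)
    have "?w \<noteq> 0\<^sub>v n"
      using h norm2_eq_0_iff[OF w] by auto
    moreover have "?w \<bullet>c v l = 0" if "l \<le> k" for l
      using mgs_sweep_orthogonal[OF on Mz, of "Suc k" l] that by simp
    ultimately show ?case
      using h by (intro orthonormal_upto_Suc[OF on w]) simp_all
  qed
  then show ?thesis by simp
qed

text \<open>
  The sum may run over all \<open>m + 1\<close> basis vectors because \<open>H\<close> is upper Hessenberg.  What remains
  after the sweep is the last term, by the normalization that defines \<open>v (k + 1)\<close>.
\<close>

lemma arnoldi_relation:
  assumes run: "inexact_flexible_arnoldi n K M b \<tau> m v z p H"
    and M: "M \<in> carrier_mat n n"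
    and v: "\<And>i. i \<le> m \<Longrightarrow> v i \<in> carrier_vec n"
    and k: "k < m" and l: "l < n"
  shows "(M *\<^sub>v z k) $ l = (\<Sum>i<m + 1. v i $ l * H $$ (i, k))"
proof -
  let ?w = "mgs_sweep v (M *\<^sub>v z k)"
  have h: "\<And>i. i \<le> k \<Longrightarrow> H $$ (i, k) = ?w i \<bullet>c v i"
    "H $$ (k + 1, k) \<noteq> 0" "v (k + 1) = (1 / H $$ (k + 1, k)) \<cdot>\<^sub>v ?w (k + 1)"
    "\<And>i. k + 1 < i \<Longrightarrow> i \<le> m \<Longrightarrow> H $$ (i, k) = 0"
    using arnoldi_step[OF run k] unfolding Suc_eq_plus1 by blast+
  have Mz: "M *\<^sub>v z k \<in> carrier_vec n" using M by (intro carrier_vecI) simp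
  have w: "?w (k + 1) \<in> carrier_vec n"
    using v k by (intro mgs_sweep_carrier[OF Mz]) simp
  have last: "?w (k + 1) $ l = v (k + 1) $ l * H $$ (k + 1, k)"
    using h(2) w l by (subst h(3)) (simp del: mgs_sweep.simps)
  have "(M *\<^sub>v z k) $ l = ?w (k + 1) $ l + (\<Sum>j<k + 1. (?w j \<bullet>c v j) * v j $ l)"
    using v k by (intro mgs_sweep_telescope[OF Mz _ l]) simp
  also have "(\<Sum>j<k + 1. (?w j \<bullet>c v j) * v j $ l) = (\<Sum>j<k + 1. v j $ l * H $$ (j, k))"
    by (intro sum.cong refl) (simp add: h(1))
  also have "?w (k + 1) $ l + \<dots> = (\<Sum>i<k + 2. v i $ l * H $$ (i, k))"
    unfolding last by simp
  also have "\<dots> = (\<Sum>i<m + 1. v i $ l * H $$ (i, k))"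
    using k h(4) by (intro sum.mono_neutral_left) auto
  finally show ?thesis .
qed

lemma shifted_hessenberg_carrier:
  assumes "H \<in> carrier_mat (m + 1) m"
  shows "shifted_hessenberg m H (mat_diag m \<tau>) \<sigma> \<in> carrier_mat (m + 1) m"
proof -
  have "1\<^sub>m m @\<^sub>r 0\<^sub>m 1 m \<in> carrier_mat (m + 1) m"
    by (rule carrier_append_rows) simp_all
  then show ?thesis
    using assms unfolding shifted_hessenberg_def
    by (intro add_carrier_mat mult_carrier_mat) (auto simp: mat_diag_def)
qed

text \<open>
  This is where the diagonal form of \<open>T\<close> enters: each column of \<open>H\<close> is scaled by the
  difference between \<open>\<sigma>\<close> and the shift that was used to produce that column.
\<close>

lemma shifted_hessenberg_index:
  assumes H: "H \<in> carrier_mat (m + 1) m" and i: "i < m + 1" and k: "k < m"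
  shows "shifted_hessenberg m H (mat_diag m \<tau>) \<sigma> $$ (i, k)
    = (if i = k then 1 else 0) + H $$ (i, k) * (\<sigma> - \<tau> k)"
proof -
  have "\<sigma> \<cdot>\<^sub>m 1\<^sub>m m - mat_diag m \<tau> = mat_diag m (\<lambda>k. \<sigma> - \<tau> k)"
    by (rule eq_matI) (auto simp: mat_diag_def)
  then have "(H * (\<sigma> \<cdot>\<^sub>m 1\<^sub>m m - mat_diag m \<tau>)) $$ (i, k) = H $$ (i, k) * (\<sigma> - \<tau> k)"
    using i k by (simp add: mat_diag_mult_right[OF H])
  moreover have "(1\<^sub>m m @\<^sub>r 0\<^sub>m 1 m) $$ (i, k) = (if i = k then 1 else 0 :: complex)"
    using i k by (auto simp: append_rows_def)
  ultimately show ?thesis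
    using i k H by (subst shifted_hessenberg_def, subst index_add_mat) (simp_all add: mat_diag_def)
qed

text \<open>
  Replacing the shift \<open>\<tau> k\<close> of the inner system by \<open>\<sigma>\<close> costs a multiple of \<open>M z k\<close>, which lies
  in the span of the basis.  Hence one basis serves all \<open>\<sigma>\<close>, and the defect \<open>P\<close> does not
  depend on \<open>\<sigma>\<close>.
\<close>

lemma shifted_arnoldi_relation:
  assumes run: "inexact_flexible_arnoldi n K M b \<tau> m v z p H"
    and K: "K \<in> carrier_mat n n" and M: "M \<in> carrier_mat n n"
    and v: "\<And>i. i \<le> m \<Longrightarrow> v i \<in> carrier_vec n"
  shows "(K + \<sigma> \<cdot>\<^sub>m M) * mat_of_cols n (map z [0..<m])
    = mat_of_cols n (map v [0..<m + 1]) * shifted_hessenberg m H (mat_diag m \<tau>) \<sigma>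
      - mat_of_cols n (map p [0..<m])"
    (is "?A * ?Z = ?V * ?S - ?P")
proof (rule eq_matI)
  have H: "H \<in> carrier_mat (m + 1) m"
    using run by (simp add: inexact_flexible_arnoldi_def)
  note S = shifted_hessenberg_carrier[OF H, of \<tau> \<sigma>]
  show "dim_row (?A * ?Z) = dim_row (?V * ?S - ?P)" "dim_col (?A * ?Z) = dim_col (?V * ?S - ?P)"
    using M S by simp_all
  fix l k assume "l < dim_row (?V * ?S - ?P)" and "k < dim_col (?V * ?S - ?P)"
  then have l: "l < n" and k: "k < m" by simp_all
  have z: "z k \<in> carrier_vec n" and p: "p k = v k - (K + \<tau> k \<cdot>\<^sub>m M) *\<^sub>v z k"
    using arnoldi_step[OF run k] by blast+
  have shift: "((K + c \<cdot>\<^sub>m M) *\<^sub>v z k) $ l = (K *\<^sub>v z k) $ l + c * (M *\<^sub>v z k) $ l" for c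
    using K M z l by (simp add: add_scalar_prod_distrib[of _ n])
  have rel: "(M *\<^sub>v z k) $ l = (\<Sum>i<m + 1. v i $ l * H $$ (i, k))"
    using run M v k l by (rule arnoldi_relation)
  have "(?A * ?Z) $$ (l, k) = (?A *\<^sub>v z k) $ l"
    using K M z l k by simp
  also have "\<dots> = v k $ l + (\<sigma> - \<tau> k) * (M *\<^sub>v z k) $ l - p k $ l"
    using K M l v[of k] k by (simp add: p shift algebra_simps del: index_mult_mat_vec)
  also have "v k $ l + (\<sigma> - \<tau> k) * (M *\<^sub>v z k) $ l
      = (\<Sum>i<m + 1. v i $ l * (if i = k then 1 else 0)) + (\<sigma> - \<tau> k) * (M *\<^sub>v z k) $ l"
    using k by (simp add: if_distrib[of "\<lambda>t. _ * t"] del: sum.lessThan_Suc cong: if_cong)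
  also have "\<dots> = (\<Sum>i<m + 1. v i $ l * ?S $$ (i, k))"
    unfolding rel sum_distrib_left
    by (subst sum.distrib[symmetric], intro sum.cong refl)
      (simp add: shifted_hessenberg_index[OF H _ k] algebra_simps)
  also have "\<dots> = (\<Sum>i<m + 1. v i $ l * col ?S k $ i)"
    using S k by (intro sum.cong refl) simp
  also have "\<dots> = (?V *\<^sub>v col ?S k) $ l"
  proof (rule mat_of_cols_mult_vec_index[symmetric])
    show "col ?S k \<in> carrier_vec (m + 1)"
      using S by (intro carrier_vecI) simp
  qed (use l v in simp_all)
  also have "\<dots> - p k $ l = (?V * ?S - ?P) $$ (l, k)"
    using S l k by (simp add: mat_of_cols_index)
  finally show "(?A * ?Z) $$ (l, k) = (?V * ?S - ?P) $$ (l, k)" .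
qed

lemma residual_gap:
  assumes run: "inexact_flexible_arnoldi n K M b \<tau> m v z p H"
    and K: "K \<in> carrier_mat n n" and M: "M \<in> carrier_mat n n"
    and b: "b \<in> carrier_vec n" "b \<noteq> 0\<^sub>v n"
    and v: "\<And>i. i \<le> m \<Longrightarrow> v i \<in> carrier_vec n"
    and y: "y \<in> carrier_vec m"
  shows "(b - (K + \<sigma> \<cdot>\<^sub>m M) *\<^sub>v (mat_of_cols n (map z [0..<m]) *\<^sub>v y))
    - mat_of_cols n (map v [0..<m + 1]) *\<^sub>v (complex_of_real (norm2 b) \<cdot>\<^sub>v unit_vec (m + 1) 0
        - shifted_hessenberg m H (mat_diag m \<tau>) \<sigma> *\<^sub>v y)
    = mat_of_cols n (map p [0..<m]) *\<^sub>v y"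
    (is "(b - ?A *\<^sub>v (?Z *\<^sub>v y)) - ?V *\<^sub>v (?e - ?S *\<^sub>v y) = ?P *\<^sub>v y")
proof -
  have H: "H \<in> carrier_mat (m + 1) m"
    using run by (simp add: inexact_flexible_arnoldi_def)
  have S: "?S \<in> carrier_mat (m + 1) m"
    by (rule shifted_hessenberg_carrier[OF H])
  have V: "?V \<in> carrier_mat n (m + 1)" and Z: "?Z \<in> carrier_mat n m"
    and P: "?P \<in> carrier_mat n m" and A: "?A \<in> carrier_mat n n"
    using K M by auto
  have "norm2 b \<noteq> 0"
    using norm2_eq_0_iff[OF b(1)] b(2) by simp
  moreover have "v 0 = complex_of_real (1 / norm2 b) \<cdot>\<^sub>v b"
    using run by (simp add: inexact_flexible_arnoldi_def)
  ultimately have v0: "complex_of_real (norm2 b) * v 0 $ l = b $ l" if "l < n" for l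
    using b(1) that by simp
  have Ve: "?V *\<^sub>v ?e = b"
  proof (rule eq_vecI)
    fix l assume "l < dim_vec b"
    then have l: "l < n" using b by simp
    have "(?V *\<^sub>v ?e) $ l = (\<Sum>i<m + 1. v i $ l * ?e $ i)"
      using l v by (intro mat_of_cols_mult_vec_index) auto
    also have "\<dots> = (\<Sum>i<m + 1. if i = 0 then b $ l else 0)"
      using v0[OF l] by (intro sum.cong refl) (auto simp: mult.commute)
    finally show "(?V *\<^sub>v ?e) $ l = b $ l" by (simp del: sum.lessThan_Suc)
  qed (use b in simp)
  have AZ: "?A * ?Z = ?V * ?S - ?P"
    using run K M v by (rule shifted_arnoldi_relation)
  have "?A *\<^sub>v (?Z *\<^sub>v y) = (?A * ?Z) *\<^sub>v y"
    using A Z y by simp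
  also have "\<dots> = (?V * ?S) *\<^sub>v y - ?P *\<^sub>v y"
    unfolding AZ using V S P y by (intro minus_mult_distrib_mat_vec) auto
  also have "(?V * ?S) *\<^sub>v y = ?V *\<^sub>v (?S *\<^sub>v y)"
    using V S y by simp
  finally have AZy: "?A *\<^sub>v (?Z *\<^sub>v y) = ?V *\<^sub>v (?S *\<^sub>v y) - ?P *\<^sub>v y" .
  have "?V *\<^sub>v (?e - ?S *\<^sub>v y) = ?V *\<^sub>v ?e - ?V *\<^sub>v (?S *\<^sub>v y)"
    using V S y by (intro mult_minus_distrib_mat_vec) auto
  then have "?V *\<^sub>v (?e - ?S *\<^sub>v y) = b - ?V *\<^sub>v (?S *\<^sub>v y)"
    unfolding Ve .
  then show ?thesis
    unfolding AZy using b by (intro eq_vecI) (simp_all del: index_mult_mat_vec)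
qed

theorem mainTheorem4:
  fixes n m nf :: nat
    and K M H V Z T :: "complex mat"
    and b :: "complex vec"
    and \<sigma> \<tau> :: "nat \<Rightarrow> complex"
    and \<epsilon> \<beta> :: real
    and v z p y x r r' :: "nat \<Rightarrow> complex vec"
  assumes "K \<in> carrier_mat n n" and "M \<in> carrier_mat n n"
    and "invertible_mat K" and "invertible_mat M"
    and "b \<in> carrier_vec n" and "b \<noteq> 0\<^sub>v n"
    and "\<And>j. j < nf \<Longrightarrow> invertible_mat (K + \<sigma> j \<cdot>\<^sub>m M)"
    and "\<And>k. k < m \<Longrightarrow> invertible_mat (K + \<tau> k \<cdot>\<^sub>m M)"
    and "\<epsilon> > 0"
    and "inexact_flexible_arnoldi n K M b \<tau> m v z p H"
    and "\<And>k. k < m \<Longrightarrow> norm2 (p k) \<le> \<epsilon>"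
    and "\<beta> = norm2 b"
    and "V = mat_of_cols n (map v [0..<m + 1])"
    and "Z = mat_of_cols n (map z [0..<m])"
    and "T = mat_diag m \<tau>"
    and "\<And>j. j < nf \<Longrightarrow> y j \<in> carrier_vec m"
    and "\<And>j. j < nf \<Longrightarrow> x j = Z *\<^sub>v y j"
    and "\<And>j. j < nf \<Longrightarrow> r j = b - (K + \<sigma> j \<cdot>\<^sub>m M) *\<^sub>v x j"
    and "\<And>j. j < nf \<Longrightarrow>
      r' j = V *\<^sub>v (complex_of_real \<beta> \<cdot>\<^sub>v unit_vec (m + 1) 0 - shifted_hessenberg m H T (\<sigma> j) *\<^sub>v y j)"
  shows "\<forall>j<nf.
      norm2 (r j - r' j) \<le> \<epsilon> * norm1 (y j) \<and>
      norm2 (r j) \<le> \<epsilon> * norm1 (y j)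
        + norm2 (complex_of_real \<beta> \<cdot>\<^sub>v unit_vec (m + 1) 0 - shifted_hessenberg m H T (\<sigma> j) *\<^sub>v y j)"
proof (intro allI impI)
  fix j assume j: "j < nf"
  note run = assms(10)
  let ?S = "shifted_hessenberg m H T (\<sigma> j)"
  let ?c = "complex_of_real \<beta> \<cdot>\<^sub>v unit_vec (m + 1) 0 - ?S *\<^sub>v y j"
  have on: "orthonormal_upto n v m"
    using run assms(2,5,6) by (rule arnoldi_orthonormal)
  then have v: "\<And>i. i \<le> m \<Longrightarrow> v i \<in> carrier_vec n"
    by (simp add: orthonormal_upto_def)
  have S: "?S \<in> carrier_mat (m + 1) m"
    using run unfolding assms(15)
    by (intro shifted_hessenberg_carrier) (simp add: inexact_flexible_arnoldi_def)
  have gap: "r j - r' j = mat_of_cols n (map p [0..<m]) *\<^sub>v y j"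
    using residual_gap[OF run assms(1,2,5,6) v assms(16)[OF j], of "\<sigma> j"]
    by (simp add: assms(12-15) assms(17-19)[OF j])
  have p: "p k \<in> carrier_vec n" if "k < m" for k
    using arnoldi_step[OF run that] assms(2) by (intro carrier_vecI) simp
  have 1: "norm2 (r j - r' j) \<le> \<epsilon> * norm1 (y j)"
    unfolding gap using assms(16)[OF j] p assms(11) by (rule norm2_mat_of_cols_mult_vec_le)
  have "?c \<in> carrier_vec (m + 1)"
    using S by (intro carrier_vecI) simp
  then have 2: "norm2 (r' j) = norm2 ?c"
    unfolding assms(19)[OF j] assms(13) by (rule norm2_orthonormal_mult_vec[OF on])
  have "dim_vec (r j) = dim_vec (r' j)"
    using assms(1,2) by (simp add: assms(13) assms(18,19)[OF j])
  then have "norm2 (r j) \<le> norm2 (r j - r' j) + norm2 (r' j)"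
    by (rule norm2_triangle)
  with 1 2 show "norm2 (r j - r' j) \<le> \<epsilon> * norm1 (y j) \<and>
      norm2 (r j) \<le> \<epsilon> * norm1 (y j) + norm2 ?c"
    by simp
qed

end
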